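(* Let $R$ be a PID and let $(M_i,\lambda_i,\partial_i)$, $i=1,2$, be formed spaces with boundary over $R$ with $\partial_i$ surjective for $i=1,2$ and such that $$(M_1,\lambda_1,\partial_1)\#X\cong(M_2,\lambda_2,\partial_2)\#X .$$ Then $(M_1,\lambda_1,\partial_1)\cong(M_2,\lambda_2,\partial_2)$.
   Context: A formed space with boundary over a commutative ring $R$ is a triple $(M,\lambda,\partial)$ with $M$ a finitely generated free $R$-module, $\lambda:M\otimes M\to R$ an alternating bilinear form ($\lambda(v,v)=0$ for all $v$), and $\partial:M\to R$ linear. Morphisms are linear maps preserving $\lambda$ and $\partial$; the category is denoted $\mathcal{F}_\partial$, and $\cong$ is isomorphism in it. Its monoidal structure is $$(M_1,\lambda_1,\partial_1)\#(M_2,\lambda_2,\partial_2)=(M_1\oplus M_2,\lambda_1\#\lambda_2,\partial_1+\partial_2),$$ $$(\lambda_1\#\lambda_2)((x_1,x_2),(y_1,y_2))=\lambda_1(x_1,y_1)+\lambda_2(x_2,y_2)+\partial_1(x_1)\partial_2(y_2)-\partial_2(x_2)\partial_1(y_1).$$ $X=(R,0,\mathrm{id})$. *)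

theory Defs
  imports "HOL-Algebra.Algebraic_Closure_Type" "HOL-Library.Product_Plus"
begin

text \<open>
  The underlying module of a formed space is a whole type \<open>'m\<close> with a scalar multiplication in the
  sense of the locale \<open>module\<close> of \<open>HOL.Modules\<close> (written \<open>Modules.module\<close>, since HOL-Algebra has a
  carrier-based notion of the same name). A form on \<open>M \<otimes> M\<close> is given as a curried bilinear map.
\<close>

record ('r, 'm) formed =
  fscale :: "'r \<Rightarrow> 'm \<Rightarrow> 'm"
  fform :: "'m \<Rightarrow> 'm \<Rightarrow> 'r"
  fbdry :: "'m \<Rightarrow> 'r"

locale formed_space = M: Modules.module "fscale A"
  for A :: "('r::comm_ring_1, 'm::ab_group_add) formed" +
  assumes fg_free: "\<exists>B. finite B \<and> M.independent B \<and> M.span B = UNIV"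
    and form_hom_right: "\<And>v. module_hom (fscale A) (*) (\<lambda>w. fform A v w)"
    and form_hom_left: "\<And>w. module_hom (fscale A) (*) (\<lambda>v. fform A v w)"
    and form_alternating: "\<And>v. fform A v v = 0"
    and bdry_hom: "module_hom (fscale A) (*) (fbdry A)"

definition formed_hom ::
  "('r::comm_ring_1, 'm::ab_group_add) formed \<Rightarrow> ('r, 'n::ab_group_add) formed \<Rightarrow> ('m \<Rightarrow> 'n) set"
  where "formed_hom A B = {f. module_hom (fscale A) (fscale B) f \<and>
    (\<forall>v w. fform B (f v) (f w) = fform A v w) \<and> (\<forall>v. fbdry B (f v) = fbdry A v)}"

definition formed_iso ::
  "('r::comm_ring_1, 'm::ab_group_add) formed \<Rightarrow> ('r, 'n::ab_group_add) formed \<Rightarrow> bool"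
  (infix "\<cong>\<^sub>\<partial>" 50)
  where "A \<cong>\<^sub>\<partial> B \<longleftrightarrow>
    (\<exists>f \<in> formed_hom A B. \<exists>g \<in> formed_hom B A. g \<circ> f = id \<and> f \<circ> g = id)"

definition formed_sum ::
  "('r::comm_ring_1, 'm::ab_group_add) formed \<Rightarrow> ('r, 'n::ab_group_add) formed
    \<Rightarrow> ('r, 'm \<times> 'n) formed" (infixl "\<sharp>" 65)
  where "A \<sharp> B = \<lparr>
    fscale = (\<lambda>r (x1, x2). (fscale A r x1, fscale B r x2)),
    fform = (\<lambda>(x1, x2) (y1, y2).
      fform A x1 y1 + fform B x2 y2 + fbdry A x1 * fbdry B y2 - fbdry B x2 * fbdry A y1),
    fbdry = (\<lambda>(x1, x2). fbdry A x1 + fbdry B x2)\<rparr>"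

definition formed_X :: "('r::comm_ring_1, 'r) formed"
  where "formed_X = \<lparr>fscale = (*), fform = (\<lambda>_ _. 0), fbdry = id\<rparr>"

lemma formed_space_X: "formed_space (formed_X :: ('r::comm_ring_1, 'r) formed)"
proof -
  interpret R: Modules.module "(*) :: 'r \<Rightarrow> 'r \<Rightarrow> 'r"
    by unfold_locales (auto simp: algebra_simps)
  have "R.independent {1}"
    by (simp add: R.dependent_finite)
  moreover have "R.span {1} = UNIV"
    by (auto simp: R.span_finite intro!: image_eqI[where x = "\<lambda>_. _"])
  ultimately have free: "\<exists>B. finite B \<and> R.independent B \<and> R.span B = UNIV"
    by blast
  show ?thesis
    unfolding formed_space_def formed_space_axioms_def formed_X_def formed.simps
    using free by (simp add: module_hom_iff R.module_axioms)
qed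

lemma formed_space_sum:
  fixes A :: "('r::comm_ring_1, 'm::ab_group_add) formed"
    and B :: "('r, 'n::ab_group_add) formed"
  assumes "formed_space A" "formed_space B"
  shows "formed_space (A \<sharp> B)"
proof -
  interpret A: formed_space A by fact
  interpret B: formed_space B by fact
  note homs = A.form_hom_left A.form_hom_right A.bdry_hom
    B.form_hom_left B.form_hom_right B.bdry_hom
  note hom_simps = homs[THEN module_hom.add] homs[THEN module_hom.scale]
  let ?s = "\<lambda>r (x, y). (fscale A r x, fscale B r y)"
  interpret P: Modules.module ?s
    by unfold_locales
      (auto simp: A.M.scale_right_distrib A.M.scale_left_distrib
        B.M.scale_right_distrib B.M.scale_left_distrib)
  have R: "Modules.module ((*) :: 'r \<Rightarrow> 'r \<Rightarrow> 'r)"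
    by unfold_locales (auto simp: algebra_simps)
  obtain S where S: "finite S" "A.M.independent S" "A.M.span S = UNIV"
    using A.fg_free by blast
  obtain T where T: "finite T" "B.M.independent T" "B.M.span T = UNIV"
    using B.fg_free by blast
  have nz: "0 \<notin> S" "0 \<notin> T"
    using S(2) T(2) A.M.dependent_zero B.M.dependent_zero by blast+
  let ?U = "(\<lambda>x. (x, 0)) ` S \<union> (\<lambda>y. (0, y)) ` T"
  have fin: "finite ?U" using S T by simp
  have sum_U: "(\<Sum>v\<in>?U. ?s (u v) v) =
      ((\<Sum>x\<in>S. fscale A (u (x, 0)) x), (\<Sum>y\<in>T. fscale B (u (0, y)) y))" for u
  proof -
    have disj: "(\<lambda>x. (x, 0)) ` S \<inter> (\<lambda>y. (0, y)) ` T = {}" using nz by auto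
    have 1: "(\<Sum>x\<in>S. (f x, 0)) = (\<Sum>x\<in>S. f x, 0)" for f :: "'m \<Rightarrow> 'm"
      using S(1) by (induction rule: finite_induct) (auto simp: zero_prod_def)
    have 2: "(\<Sum>y\<in>T. (0, f y)) = (0, \<Sum>y\<in>T. f y)" for f :: "'n \<Rightarrow> 'n"
      using T(1) by (induction rule: finite_induct) (auto simp: zero_prod_def)
    show ?thesis
      by (subst sum.union_disjoint) (use S T disj in
        \<open>auto simp: sum.reindex inj_on_def 1 2\<close>)
  qed
  have indep: "P.independent ?U"
    unfolding P.dependent_finite[OF fin] sum_U
    using S(1,2) T(1,2) by (auto simp: zero_prod_def A.M.dependent_finite B.M.dependent_finite)
  have span: "(x, y) \<in> P.span ?U" for x y
  proof -
    obtain f where f: "x = (\<Sum>v\<in>S. fscale A (f v) v)"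
      using S A.M.span_finite[OF S(1)] by auto
    obtain g where g: "y = (\<Sum>v\<in>T. fscale B (g v) v)"
      using T B.M.span_finite[OF T(1)] by auto
    define u where "u = (\<lambda>(v, w). if w = 0 then f v else g w)"
    have "(\<Sum>v\<in>?U. ?s (u v) v) = (x, y)"
      unfolding sum_U f g u_def using nz by (auto intro!: sum.cong)
    then show ?thesis
      unfolding P.span_finite[OF fin] by (auto intro!: range_eqI[where x = u])
  qed
  have free: "\<exists>U. finite U \<and> P.independent U \<and> P.span U = UNIV"
    using fin indep span by (intro exI[of _ ?U]) auto
  have scale: "fscale (A \<sharp> B) = ?s"
    by (simp add: formed_sum_def)
  have form: "fform (A \<sharp> B) v w = fform A (fst v) (fst w) + fform B (snd v) (snd w) +
      fbdry A (fst v) * fbdry B (snd w) - fbdry B (snd v) * fbdry A (fst w)" for v w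
    by (simp add: formed_sum_def split_beta)
  have bdry: "fbdry (A \<sharp> B) v = fbdry A (fst v) + fbdry B (snd v)" for v
    by (simp add: formed_sum_def split_beta)
  have s: "fst (?s r v) = fscale A r (fst v)" "snd (?s r v) = fscale B r (snd v)" for r v
    by (simp_all add: split_beta)
  show ?thesis
    unfolding formed_space_def formed_space_axioms_def scale
  proof (intro conjI allI)
    show "Modules.module ?s" by (rule P.module_axioms)
    show "\<exists>U. finite U \<and> P.independent U \<and> P.span U = UNIV" by (rule free)
    show "module_hom ?s (*) (fform (A \<sharp> B) v)" for v
      unfolding module_hom_iff form fst_add snd_add s hom_simps
      by (simp add: P.module_axioms R algebra_simps)
    show "module_hom ?s (*) (\<lambda>v. fform (A \<sharp> B) v w)" for w
      unfolding module_hom_iff form fst_add snd_add s hom_simps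
      by (simp add: P.module_axioms R algebra_simps)
    show "fform (A \<sharp> B) v v = 0" for v
      by (simp add: form A.form_alternating B.form_alternating)
    show "module_hom ?s (*) (fbdry (A \<sharp> B))"
      unfolding module_hom_iff bdry fst_add snd_add s hom_simps
      by (simp add: P.module_axioms R algebra_simps)
  qed
qed

end

theory Submission
  imports Defs
begin

text \<open>
  Inside \<open>A \<sharp> X\<close> the kernel of the boundary is the graph of \<open>- \<partial>\<close>. The cross terms of the form cancel
  on it, so it is a copy of \<open>(M, \<lambda>)\<close>; and pairing with the generator \<open>(0, 1)\<close> of \<open>X\<close>, which has boundary
  1, gives \<open>- \<partial>\<close> back. Any other element of boundary 1 differs from \<open>(0, 1)\<close> by an element of the kernel, so
  what \<open>A \<sharp> X\<close> remembers of \<open>A\<close> is \<open>(M, \<lambda>)\<close> together with \<open>\<partial>\<close> modulo the functionals \<open>\<lambda>(m, _)\<close>. Hence the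
  hypothesis gives an isomorphism from \<open>twist A1 m\<close>, which is \<open>A1\<close> with boundary \<open>\<partial> + \<lambda>(m, _)\<close>, to \<open>A2\<close>
  for some \<open>m\<close> (\<open>twist_iso_of_sum_X_iso\<close>).

  It remains to see that two surjective functionals \<open>\<partial>\<close> and \<open>\<partial>' = \<partial> + \<lambda>(m, _)\<close> lie in one orbit of the
  isometry group of \<open>(M, \<lambda>)\<close> (\<open>twist_iso\<close>). The isometries used move vectors only along the
  submodule spanned by two vectors \<open>u\<close> and \<open>v\<close> (\<open>plane_twist_iso\<close>). If \<open>e\<close> has \<open>\<partial> e = 1\<close>, one with
  \<open>v = e\<close> and \<open>u = m - \<partial>(m) e\<close> takes \<open>\<partial>\<close> to \<open>\<partial>'\<close> as soon as \<open>\<partial>' e\<close> and \<open>\<partial> m\<close> generate the unit ideal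
  (\<open>comaximal_twist_iso\<close>). Adding to \<open>e\<close> an element of the kernel of \<open>\<partial>\<close> keeps \<open>\<partial> e = 1\<close> and, \<open>\<partial>'\<close> being
  surjective, changes \<open>\<partial>' e\<close> by the multiples of an element coprime to it. In a principal ideal domain some such
  change makes \<open>\<partial>' e\<close> coprime to \<open>\<partial> m\<close>, provided that \<open>\<partial> m\<close> is not 0 (\<open>comaximal_translate\<close>); and
  if it is 0, a transvection applied beforehand makes it nonzero.
\<close>

section \<open>Arithmetic in a principal ideal domain\<close>

lemma principal_domain_generator:
  fixes I :: "'r::idom set"
  assumes "principal_domain (ring_of_type_algebra :: 'r ring)"
    and "0 \<in> I" and add: "\<And>x y. x \<in> I \<Longrightarrow> y \<in> I \<Longrightarrow> x + y \<in> I"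
    and mult: "\<And>r x. x \<in> I \<Longrightarrow> r * x \<in> I"
  shows "\<exists>d. I = {r. d dvd r}"
proof -
  let ?R = "ring_of_type_algebra :: 'r ring"
  interpret R: principal_domain ?R by fact
  have ops [simp]: "carrier ?R = UNIV" "monoid.mult ?R = (*)" "add ?R = (+)" "zero ?R = 0"
    by (simp_all add: ring_of_type_algebra_def fun_eq_iff)
  have a_inv: "a_inv ?R x = - x" for x
    by (rule R.minus_equality) auto
  have "subgroup I (add_monoid ?R)"
  proof (rule R.add.subgroupI)
    show "\<ominus>\<^bsub>?R\<^esub> x \<in> I" if "x \<in> I" for x
      using mult[OF that, of "- 1"] by (simp add: a_inv)
  qed (use assms in auto)
  then have "ideal I ?R"
    using mult by (intro idealI R.ring_axioms) (auto simp: mult.commute)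
  then obtain d where "I = PIdl\<^bsub>?R\<^esub> d"
    using R.exists_gen by auto
  then have "I = {r. d dvd r}"
    by (auto simp: cgenideal_def dvd_def mult.commute)
  then show ?thesis ..
qed

definition comaximal :: "'r::comm_ring_1 \<Rightarrow> 'r \<Rightarrow> bool"
  where "comaximal x y \<longleftrightarrow> (\<exists>p q. p * x + q * y = 1)"

lemma comaximal_commute: "comaximal x y \<longleftrightarrow> comaximal y x"
  unfolding comaximal_def by (metis add.commute)

lemma comaximal_mult:
  assumes "comaximal x y" and "comaximal x z"
  shows "comaximal x (y * z)"
proof -
  obtain p q p' q' where pq: "p * x + q * y = 1" "p' * x + q' * z = 1"
    using assms unfolding comaximal_def by blast
  have "(p * (p' * x + q' * z) + q * y * p') * x + (q * q') * (y * z)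
      = (p * x + q * y) * (p' * x + q' * z)"
    by (simp add: algebra_simps)
  then show ?thesis
    unfolding comaximal_def using pq by (metis mult_1)
qed

lemma comaximal_power: "comaximal x y \<Longrightarrow> comaximal x (y ^ n)"
proof (induction n)
  case 0
  have "0 * x + 1 * y ^ 0 = 1" by simp
  then show ?case unfolding comaximal_def by blast
qed (simp add: comaximal_mult)

lemma comaximal_dvd:
  assumes "comaximal x z" and "y dvd z"
  shows "comaximal x y"
  using assms unfolding comaximal_def dvd_def by (metis mult.commute mult.assoc)

lemma comaximal_add_mult:
  assumes "comaximal x y"
  shows "comaximal (x + y * z) y"
proof -
  obtain p q where "p * x + q * y = 1"
    using assms unfolding comaximal_def by blast
  then have "p * (x + y * z) + (q - p * z) * y = 1"
    by (simp add: algebra_simps)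
  then show ?thesis unfolding comaximal_def by blast
qed

text \<open>
  Here \<open>b\<close> is the part of \<open>a\<close> prime to \<open>x\<close>. It is found without factoring \<open>a\<close>, as a generator of the
  saturation \<open>(a : x\<^sup>\<infinity>)\<close>: a common divisor of \<open>b\<close> and \<open>x\<close> could be cancelled from \<open>b\<close> without leaving that
  ideal, so it is a unit.
\<close>
lemma coprime_part:
  fixes a x :: "'r::idom"
  assumes "principal_domain (ring_of_type_algebra :: 'r ring)" and "a \<noteq> 0"
  shows "\<exists>b n. comaximal x b \<and> a dvd b * x ^ n"
proof -
  define J where "J = {r. \<exists>n. a dvd r * x ^ n}"
  have "r + s \<in> J" if rs: "r \<in> J" "s \<in> J" for r s
  proof -
    obtain k l where "a dvd r * x ^ k" "a dvd s * x ^ l"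
      using rs unfolding J_def by blast
    then have "a dvd r * x ^ k * x ^ l + s * x ^ l * x ^ k"
      by (intro dvd_add) (rule dvd_mult2, assumption)+
    then have "a dvd (r + s) * x ^ (k + l)"
      by (simp add: algebra_simps power_add)
    then show ?thesis unfolding J_def by blast
  qed
  moreover have "r * s \<in> J" if "s \<in> J" for r s
    using that unfolding J_def by (auto simp: mult.assoc intro: dvd_mult)
  moreover have "0 \<in> J" by (simp add: J_def)
  ultimately obtain b where b: "J = {r. b dvd r}"
    using principal_domain_generator[OF assms(1), of J] by blast
  have "a \<in> J" unfolding J_def by (auto intro: exI[of _ 0])
  then have "b \<noteq> 0" using b assms(2) by auto
  have "b \<in> J" using b by simp
  then obtain n where n: "a dvd b * x ^ n" unfolding J_def by blast
  define I where "I = {p * x + q * b | p q. True}"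
  have "r + s \<in> I" if rs: "r \<in> I" "s \<in> I" for r s
  proof -
    obtain p q p' q' where "r = p * x + q * b" "s = p' * x + q' * b"
      using rs unfolding I_def by blast
    then have "r + s = (p + p') * x + (q + q') * b" by (simp add: algebra_simps)
    then show ?thesis unfolding I_def by blast
  qed
  moreover have "r * s \<in> I" if s: "s \<in> I" for r s
  proof -
    obtain p q where "s = p * x + q * b" using s unfolding I_def by blast
    then have "r * s = (r * p) * x + (r * q) * b" by (simp add: algebra_simps)
    then show ?thesis unfolding I_def by blast
  qed
  moreover have "0 \<in> I"
    unfolding I_def by (auto intro!: exI[of _ 0])
  ultimately obtain d where d: "I = {r. d dvd r}"
    using principal_domain_generator[OF assms(1), of I] by blast
  have "x = 1 * x + 0 * b" "b = 0 * x + 1 * b" by simp_all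
  then have "x \<in> I" "b \<in> I" unfolding I_def by blast+
  then obtain e f where e: "b = d * e" and f: "x = d * f"
    using d unfolding dvd_def by blast
  \<comment> \<open>cancelling the common divisor \<open>d\<close> from \<open>b\<close> costs one more factor \<open>x\<close>, so \<open>e\<close> stays in \<open>J\<close>\<close>
  have "e * x ^ Suc n = f * (b * x ^ n)"
    using e f by (simp add: algebra_simps)
  then have "e \<in> J"
    using n unfolding J_def by (metis (mono_tags, lifting) dvd_mult mem_Collect_eq)
  then have "b dvd e" using b by simp
  then obtain h where h: "e = b * h" ..
  have "b * 1 = b * (d * h)" using e h by (simp add: ac_simps)
  then have "1 = d * h" using \<open>b \<noteq> 0\<close> by (metis mult_cancel_left)
  then have "d dvd 1" by (rule dvdI)
  then have "1 \<in> I" using d by simp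
  then have "comaximal x b" unfolding I_def comaximal_def by force
  with n show ?thesis by blast
qed

text \<open>
  With \<open>t = b\<close> the part of \<open>a\<close> prime to \<open>x\<close>, the element \<open>x + b * c\<close> is coprime to \<open>b\<close> because
  \<open>x\<close> is, and to \<open>x\<close> because both \<open>b\<close> and \<open>c\<close> are; and \<open>a\<close> divides a product of \<open>b\<close> and a power of \<open>x\<close>.
\<close>
lemma comaximal_translate:
  fixes a x c :: "'r::idom"
  assumes "principal_domain (ring_of_type_algebra :: 'r ring)" and "a \<noteq> 0"
    and xc: "comaximal x c"
  shows "\<exists>t. comaximal (x + t * c) a"
proof -
  obtain b n where b: "comaximal x b" "a dvd b * x ^ n"
    using coprime_part[OF assms(1,2)] by blast
  have "comaximal (b * c) x"
    using comaximal_mult[OF b(1) xc] comaximal_commute by blast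
  then have "comaximal (b * c + x * 1) x" by (rule comaximal_add_mult)
  then have "comaximal (x + b * c) (x ^ n)"
    by (intro comaximal_power) (simp add: add.commute)
  moreover have "comaximal (x + b * c) b"
    by (rule comaximal_add_mult) fact
  ultimately show ?thesis
    using b(2) comaximal_mult comaximal_dvd by blast
qed

section \<open>Isomorphisms of formed spaces\<close>

lemma formed_isoI:
  assumes "f \<in> formed_hom A B" and "g \<in> formed_hom B A"
    and "\<And>x. g (f x) = x" and "\<And>y. f (g y) = y"
  shows "A \<cong>\<^sub>\<partial> B"
proof -
  have "g \<circ> f = id" "f \<circ> g = id"
    using assms(3,4) by (simp_all add: fun_eq_iff)
  then show ?thesis
    unfolding formed_iso_def using assms(1,2) by blast
qed

lemma formed_iso_sym: "A \<cong>\<^sub>\<partial> B \<Longrightarrow> B \<cong>\<^sub>\<partial> A"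
  unfolding formed_iso_def by blast

lemma formed_hom_comp:
  assumes "f \<in> formed_hom A B" and "g \<in> formed_hom B C"
  shows "g \<circ> f \<in> formed_hom A C"
  using assms module_hom_compose unfolding formed_hom_def by auto

lemma formed_iso_trans:
  assumes "A \<cong>\<^sub>\<partial> B" and "B \<cong>\<^sub>\<partial> C"
  shows "A \<cong>\<^sub>\<partial> C"
proof -
  obtain f g where f: "f \<in> formed_hom A B" "g \<in> formed_hom B A" "g \<circ> f = id" "f \<circ> g = id"
    using assms(1) unfolding formed_iso_def by blast
  obtain h k where h: "h \<in> formed_hom B C" "k \<in> formed_hom C B" "k \<circ> h = id" "h \<circ> k = id"
    using assms(2) unfolding formed_iso_def by blast
  have "(g \<circ> k) \<circ> (h \<circ> f) = g \<circ> (k \<circ> h) \<circ> f" "(h \<circ> f) \<circ> (g \<circ> k) = h \<circ> (f \<circ> g) \<circ> k"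
    by (simp_all add: comp_assoc)
  then have "(g \<circ> k) \<circ> (h \<circ> f) = id" "(h \<circ> f) \<circ> (g \<circ> k) = id"
    using f h by simp_all
  moreover have "h \<circ> f \<in> formed_hom A C" "g \<circ> k \<in> formed_hom C A"
    using f h formed_hom_comp by blast+
  ultimately show ?thesis
    unfolding formed_iso_def by blast
qed

lemma surj_bdry_iso:
  assumes "A \<cong>\<^sub>\<partial> B" and "surj (fbdry B)"
  shows "surj (fbdry A)"
proof -
  obtain g where "g \<in> formed_hom B A"
    using assms(1) unfolding formed_iso_def by blast
  then have "fbdry A (g v) = fbdry B v" for v
    unfolding formed_hom_def by blast
  then show ?thesis using assms(2) by (metis surj_def)
qed

section \<open>Changing the boundary by an isometry\<close>

definition twist :: "('r::comm_ring_1, 'm::ab_group_add) formed \<Rightarrow> 'm \<Rightarrow> ('r, 'm) formed"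
  where "twist A w = A\<lparr>fbdry := \<lambda>x. fbdry A x + fform A w x\<rparr>"

lemma twist_simps [simp]:
  "fscale (twist A w) = fscale A" "fform (twist A w) = fform A"
  "fbdry (twist A w) x = fbdry A x + fform A w x"
  by (simp_all add: twist_def)

lemma module_ring: "Modules.module ((*) :: 'r::comm_ring_1 \<Rightarrow> 'r \<Rightarrow> 'r)"
  by unfold_locales (auto simp: algebra_simps)

context formed_space
begin

lemmas homs = form_hom_left form_hom_right bdry_hom

lemma form_simps:
  "fform A (v + v') w = fform A v w + fform A v' w"
  "fform A v (w + w') = fform A v w + fform A v w'"
  "fform A (v - v') w = fform A v w - fform A v' w"
  "fform A v (w - w') = fform A v w - fform A v w'"
  "fform A (fscale A r v) w = r * fform A v w"
  "fform A v (fscale A r w) = r * fform A v w"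
  "fbdry A (v + v') = fbdry A v + fbdry A v'"
  "fbdry A (v - v') = fbdry A v - fbdry A v'"
  "fbdry A (fscale A r v) = r * fbdry A v"
  "fform A v v = 0"
  by (rule homs[THEN module_hom.add] homs[THEN module_hom.diff] homs[THEN module_hom.scale]
      form_alternating)+

lemma form_antisym: "fform A w v = - fform A v w"
proof -
  have "fform A w v + fform A v w = fform A (v + w) (v + w)"
    unfolding form_simps(1,2) by (simp add: form_alternating add.commute)
  then have "fform A w v + fform A v w = 0"
    by (simp only: form_alternating)
  then show ?thesis by (simp only: eq_neg_iff_add_eq_0)
qed

lemma formed_space_twist: "formed_space (twist A w)"
  unfolding formed_space_def formed_space_axioms_def
  using M.module_axioms fg_free form_hom_left form_hom_right
  by (simp add: module_hom_iff module_ring form_simps algebra_simps)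

lemma twist_twist: "twist (twist A v) w = twist A (v + w)"
  by (simp add: twist_def form_simps add.assoc)

text \<open>
  This is \<open>1 + L B L*\<close>, where \<open>L : R\<^sup>2 \<rightarrow> M\<close> has columns \<open>u, v\<close>, where \<open>L* x = (\<lambda>(u, x), \<lambda>(v, x))\<close>,
  and where \<open>B\<close> is the matrix with rows \<open>(\<alpha>, \<beta>)\<close> and \<open>(\<gamma>, \<delta>)\<close>. As \<open>L* L = s J\<close>, with \<open>s = \<lambda>(u, v)\<close> and
  \<open>J\<close> the standard symplectic matrix, it is an isometry when \<open>B\<^sup>T - B + s det(B) J = 0\<close>.
\<close>
definition plane_map :: "'m \<Rightarrow> 'm \<Rightarrow> 'r \<Rightarrow> 'r \<Rightarrow> 'r \<Rightarrow> 'r \<Rightarrow> 'm \<Rightarrow> 'm"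
  where "plane_map u v \<alpha> \<beta> \<gamma> \<delta> x = x
    + fscale A (\<alpha> * fform A u x + \<beta> * fform A v x) u
    + fscale A (\<gamma> * fform A u x + \<delta> * fform A v x) v"

lemma plane_map_hom: "module_hom (fscale A) (fscale A) (plane_map u v \<alpha> \<beta> \<gamma> \<delta>)"
  unfolding module_hom_iff plane_map_def
  by (simp add: M.module_axioms form_simps algebra_simps)

lemma plane_map_isometry:
  assumes "\<beta> - \<gamma> = fform A u v * (\<alpha> * \<delta> - \<beta> * \<gamma>)"
  shows "fform A (plane_map u v \<alpha> \<beta> \<gamma> \<delta> x) (plane_map u v \<alpha> \<beta> \<gamma> \<delta> y) = fform A x y"
proof -
  let ?X = "fform A u x" and ?X' = "fform A v x" and ?Y = "fform A u y" and ?Y' = "fform A v y"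
  have "fform A (plane_map u v \<alpha> \<beta> \<gamma> \<delta> x) (plane_map u v \<alpha> \<beta> \<gamma> \<delta> y) = fform A x y
      + (fform A u v * (\<alpha> * \<delta> - \<beta> * \<gamma>) - (\<beta> - \<gamma>)) * (?X * ?Y' - ?X' * ?Y)"
    unfolding plane_map_def
    by (simp add: form_simps form_antisym[of x u] form_antisym[of x v] form_antisym[of v u] algebra_simps)
  then show ?thesis using assms by simp
qed

text \<open>
  Since \<open>\<lambda>\<close> may be degenerate, an isometry need not be invertible. The inverse belongs to the matrix
  \<open>- B\<^sup>T\<close>: since \<open>B J B\<^sup>T = det(B) J\<close>, the coefficient matrix \<open>B - B\<^sup>T - s B J B\<^sup>T\<close> of the composite minus the
  identity vanishes by the condition on \<open>B\<close>.
\<close>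
lemma plane_map_inverse:
  assumes "\<beta> - \<gamma> = fform A u v * (\<alpha> * \<delta> - \<beta> * \<gamma>)"
  shows "plane_map u v \<alpha> \<beta> \<gamma> \<delta> (plane_map u v (- \<alpha>) (- \<gamma>) (- \<beta>) (- \<delta>) x) = x"
proof -
  define s where "s = fform A u v"
  define U where "U = fform A u x"
  define V where "V = fform A v x"
  have s: "fform A v u = - s" unfolding s_def by (rule form_antisym)
  define p where "p = - \<alpha> * U - \<gamma> * V"
  define q where "q = - \<beta> * U - \<delta> * V"
  have inner: "plane_map u v (- \<alpha>) (- \<gamma>) (- \<beta>) (- \<delta>) x = x + fscale A p u + fscale A q v"
    by (simp add: plane_map_def p_def q_def U_def V_def)
  have "\<alpha> * (U + q * s) + \<beta> * (V - p * s) = - p + V * ((\<beta> - \<gamma>) - s * (\<alpha> * \<delta> - \<beta> * \<gamma>))"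
    by (simp add: p_def q_def algebra_simps)
  then have 1: "\<alpha> * (U + q * s) + \<beta> * (V - p * s) = - p"
    using assms by (simp add: s_def)
  have "\<gamma> * (U + q * s) + \<delta> * (V - p * s) = - q - U * ((\<beta> - \<gamma>) - s * (\<alpha> * \<delta> - \<beta> * \<gamma>))"
    by (simp add: p_def q_def algebra_simps)
  then have 2: "\<gamma> * (U + q * s) + \<delta> * (V - p * s) = - q"
    using assms by (simp add: s_def)
  have "fform A u (x + fscale A p u + fscale A q v) = U + q * s"
    "fform A v (x + fscale A p u + fscale A q v) = V - p * s"
    by (simp_all add: form_simps s U_def V_def s_def)
  then show ?thesis
    by (simp add: inner plane_map_def[of _ _ _ _ _ _ "x + fscale A p u + fscale A q v"] 1 2)
qed

lemma plane_twist_iso: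
  assumes eq: "\<beta> - \<gamma> = fform A u v * (\<alpha> * \<delta> - \<beta> * \<gamma>)"
  shows "twist A (fscale A (\<alpha> * fbdry A u + \<gamma> * fbdry A v) u
    + fscale A (\<beta> * fbdry A u + \<delta> * fbdry A v) v) \<cong>\<^sub>\<partial> A" (is "?T \<cong>\<^sub>\<partial> A")
proof -
  let ?g = "plane_map u v \<alpha> \<beta> \<gamma> \<delta>" and ?h = "plane_map u v (- \<alpha>) (- \<gamma>) (- \<beta>) (- \<delta>)"
  have eq': "- \<gamma> - - \<beta> = fform A u v * (- \<alpha> * - \<delta> - - \<gamma> * - \<beta>)"
    using eq by (simp add: mult.commute)
  have bdry: "fbdry A (?g x) = fbdry ?T x" for x
    by (simp add: plane_map_def form_simps algebra_simps)
  have gh: "?g (?h x) = x" and hg: "?h (?g x) = x" for x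
    using plane_map_inverse[OF eq] plane_map_inverse[OF eq'] by simp_all
  have bdry': "fbdry ?T (?h x) = fbdry A x" for x
    using bdry[of "?h x"] by (simp only: gh)
  have "?g \<in> formed_hom ?T A"
    unfolding formed_hom_def using bdry
    by (simp add: plane_map_hom plane_map_isometry[OF eq] del: twist_simps(3))
  moreover have "?h \<in> formed_hom A ?T"
    unfolding formed_hom_def using bdry'
    by (simp add: plane_map_hom plane_map_isometry[OF eq'] del: twist_simps(3))
  ultimately show ?thesis
    using hg gh by (rule formed_isoI)
qed

lemma transvection_iso: "twist A (fscale A (fbdry A e) e) \<cong>\<^sub>\<partial> A"
  using plane_twist_iso[of 0 0 e 0 1 0] by (simp add: form_simps)

lemma comaximal_twist_iso:
  assumes e: "fbdry A e = 1" and co: "comaximal (fbdry (twist A m) e) (fbdry A m)"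
  shows "twist A m \<cong>\<^sub>\<partial> A"
proof -
  define a where "a = fbdry A m"
  define s where "s = fform A m e"
  define u where "u = m - fscale A a e"
  obtain p q where pq: "p * (1 + s) + q * a = 1"
    using co e unfolding comaximal_def a_def s_def by auto
  have u: "fbdry A u = 0" "fform A u e = s"
    by (simp_all add: u_def a_def s_def form_simps e)
  \<comment> \<open>With \<open>\<gamma> = 1\<close> and \<open>\<delta> = a\<close> the resulting twist is by \<open>u + a e = m\<close>, and the isometry condition reads
    \<open>\<beta> (1 + s) - \<alpha> s a = 1\<close>; writing \<open>q a = q a (1 + s) - q a s\<close> in \<open>pq\<close> gives the solution used here.\<close>
  have "(p + q * a) - 1 = s * (q * a - (p + q * a) * 1)"
    using pq by (auto simp: algebra_simps)
  then have "twist A (fscale A (q * fbdry A u + 1 * fbdry A e) u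
      + fscale A ((p + q * a) * fbdry A u + a * fbdry A e) e) \<cong>\<^sub>\<partial> A"
    using u by (intro plane_twist_iso) simp
  then show ?thesis using u e by (simp add: u_def)
qed

end

text \<open>
  If \<open>\<partial>' z = 1\<close> then the projection \<open>k\<close> of \<open>z\<close> to the kernel of \<open>\<partial>\<close> along \<open>e\<close> satisfies
  \<open>\<partial>(z) \<partial>' e + \<partial>' k = 1\<close>, so translating \<open>e\<close> by multiples of \<open>k\<close> moves \<open>\<partial>' e\<close> by multiples of an element
  coprime to it.
\<close>
lemma twist_iso_of_bdry_nonzero:
  fixes A :: "('r::idom, 'm::ab_group_add) formed"
  assumes pid: "principal_domain (ring_of_type_algebra :: 'r ring)"
    and A: "formed_space A"
    and surj: "surj (fbdry A)" "surj (fbdry (twist A m))"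
    and nz: "fbdry A m \<noteq> 0"
  shows "twist A m \<cong>\<^sub>\<partial> A"
proof -
  interpret formed_space A by fact
  interpret T: formed_space "twist A m" by (rule formed_space_twist)
  obtain e where e: "fbdry A e = 1" using surj(1) by (metis surj_def)
  obtain z where z: "fbdry (twist A m) z = 1" using surj(2) by (metis surj_def)
  define k where "k = z - fscale A (fbdry A z) e"
  have k: "fbdry A k = 0"
    by (simp add: k_def form_simps e)
  have "fbdry A z * fbdry (twist A m) e + 1 * fbdry (twist A m) k = 1"
    using T.form_simps(8)[of z "fscale A (fbdry A z) e"] T.form_simps(9)[of "fbdry A z" e] z
    by (simp add: k_def del: twist_simps(3))
  then have "comaximal (fbdry (twist A m) e) (fbdry (twist A m) k)"
    unfolding comaximal_def by blast
  then obtain t where "comaximal (fbdry (twist A m) e + t * fbdry (twist A m) k) (fbdry A m)"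
    using comaximal_translate[OF pid nz] by blast
  then have "comaximal (fbdry (twist A m) (e + fscale A t k)) (fbdry A m)"
    using T.form_simps(7)[of e "fscale A t k"] T.form_simps(9)[of t k]
    by (simp del: twist_simps(3))
  moreover have "fbdry A (e + fscale A t k) = 1"
    by (simp add: form_simps e k)
  ultimately show ?thesis by (intro comaximal_twist_iso)
qed

text \<open>
  When \<open>\<partial> m = 0\<close>, the boundary is first changed by the transvection along an \<open>e\<close> with \<open>\<partial> e = 1\<close>. The
  remaining twist is by \<open>m - e\<close>, on which the new boundary is \<open>- \<partial>' e\<close>, so \<open>e\<close> is chosen with
  \<open>\<partial>' e \<noteq> 0\<close>.
\<close>
lemma twist_iso:
  fixes A :: "('r::idom, 'm::ab_group_add) formed"
  assumes pid: "principal_domain (ring_of_type_algebra :: 'r ring)"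
    and A: "formed_space A"
    and surj: "surj (fbdry A)" "surj (fbdry (twist A m))"
  shows "twist A m \<cong>\<^sub>\<partial> A"
proof (cases "fbdry A m = 0")
  case False
  then show ?thesis using twist_iso_of_bdry_nonzero assms by blast
next
  case True
  interpret formed_space A by fact
  interpret T: formed_space "twist A m" by (rule formed_space_twist)
  have "\<exists>e. fbdry A e = 1 \<and> fbdry (twist A m) e \<noteq> 0"
  proof -
    obtain e where e: "fbdry A e = 1" using surj(1) by (metis surj_def)
    obtain z where z: "fbdry (twist A m) z = 1" using surj(2) by (metis surj_def)
    define k where "k = z - fscale A (fbdry A z) e"
    have "fbdry A (e + k) = 1"
      by (simp add: k_def form_simps e)
    moreover have "fbdry (twist A m) (e + k) = 1" if "fbdry (twist A m) e = 0"
      using T.form_simps(7)[of e k] T.form_simps(8)[of z "fscale A (fbdry A z) e"]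
        T.form_simps(9)[of "fbdry A z" e] z that
      by (simp add: k_def del: twist_simps(3))
    \<comment> \<open>so one of \<open>e\<close> and \<open>e + k\<close> will do\<close>
    ultimately show ?thesis using e by (metis zero_neq_one)
  qed
  then obtain e where e: "fbdry A e = 1" "fbdry (twist A m) e \<noteq> 0" by blast
  let ?B = "twist A e"
  have iso: "?B \<cong>\<^sub>\<partial> A"
    using transvection_iso[of e] e by simp
  have twist: "twist ?B (m - e) = twist A m" by (simp add: twist_twist)
  have "fbdry ?B (m - e) = - fbdry (twist A m) e"
    using True e form_antisym[of e m] by (simp add: form_simps)
  then have nz: "fbdry ?B (m - e) \<noteq> 0"
    using e(2) by (simp only: neg_equal_0_iff_equal not_False_eq_True)
  have "surj (fbdry (twist ?B (m - e)))" "surj (fbdry ?B)"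
    using surj surj_bdry_iso[OF iso] by (simp_all only: twist)
  then have "twist ?B (m - e) \<cong>\<^sub>\<partial> ?B"
    using twist_iso_of_bdry_nonzero[OF pid formed_space_twist] nz by blast
  then show ?thesis using iso formed_iso_trans twist by metis
qed

section \<open>The kernel of the boundary on a sum with X\<close>

lemma sum_X_simps:
  "fscale (A \<sharp> formed_X) r (x, a) = (fscale A r x, r * a)"
  "fform (A \<sharp> formed_X) (x, a) (y, b) = fform A x y + fbdry A x * b - a * fbdry A y"
  "fbdry (A \<sharp> formed_X) (x, a) = fbdry A x + a"
  by (simp_all add: formed_sum_def formed_X_def)

text \<open>
  The restriction of \<open>F\<close> to the kernels of the boundaries, read through the isomorphisms
  \<open>x \<mapsto> (x, - \<partial> x)\<close> from the underlying modules.
\<close>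
definition kernel_map ::
  "('r::comm_ring_1, 'm::ab_group_add) formed \<Rightarrow> ('m \<times> 'r \<Rightarrow> 'n \<times> 'r) \<Rightarrow> 'm \<Rightarrow> 'n"
  where "kernel_map A F x = fst (F (x, - fbdry A x))"

lemma kernel_map_lift:
  assumes "F \<in> formed_hom (A \<sharp> formed_X) (B \<sharp> formed_X)"
  shows "F (x, - fbdry A x) = (kernel_map A F x, - fbdry B (kernel_map A F x))"
proof -
  obtain y b where y: "F (x, - fbdry A x) = (y, b)" by (cases "F (x, - fbdry A x)")
  have "fbdry (B \<sharp> formed_X) (y, b) = fbdry (A \<sharp> formed_X) (x, - fbdry A x)"
    using assms y unfolding formed_hom_def by (metis (mono_tags, lifting) mem_Collect_eq)
  then have "b = - fbdry B y"
    by (simp add: sum_X_simps eq_neg_iff_add_eq_0 add.commute)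
  then show ?thesis by (simp add: kernel_map_def y)
qed

lemma kernel_map_form:
  assumes "F \<in> formed_hom (A \<sharp> formed_X) (B \<sharp> formed_X)"
  shows "fform B (kernel_map A F x) (kernel_map A F y) = fform A x y"
proof -
  have "fform (B \<sharp> formed_X) (F (x, - fbdry A x)) (F (y, - fbdry A y))
      = fform (A \<sharp> formed_X) (x, - fbdry A x) (y, - fbdry A y)"
    using assms unfolding formed_hom_def by blast
  then show ?thesis by (simp add: kernel_map_lift[OF assms] sum_X_simps)
qed

lemma kernel_map_hom:
  assumes "formed_space A" and "formed_space B"
    and F: "F \<in> formed_hom (A \<sharp> formed_X) (B \<sharp> formed_X)"
  shows "module_hom (fscale A) (fscale B) (kernel_map A F)"
proof -
  interpret A: formed_space A by fact
  interpret B: formed_space B by fact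
  interpret F: module_hom "fscale (A \<sharp> formed_X)" "fscale (B \<sharp> formed_X)" F
    using F unfolding formed_hom_def by blast
  have "kernel_map A F (x + y) = kernel_map A F x + kernel_map A F y" for x y
    using F.add[of "(x, - fbdry A x)" "(y, - fbdry A y)"]
    by (simp add: kernel_map_def A.form_simps)
  moreover have "kernel_map A F (fscale A r x) = fscale B r (kernel_map A F x)" for r x
    using F.scale[of r "(x, - fbdry A x)"]
    by (simp add: kernel_map_lift[OF F] sum_X_simps) (simp add: kernel_map_def A.form_simps)
  ultimately show ?thesis
    unfolding module_hom_iff using A.M.module_axioms B.M.module_axioms by blast
qed

text \<open>
  Let \<open>f\<close> be the isometry induced by \<open>F\<close>, and let \<open>F(0, 1) = (n, c)\<close>, so that \<open>\<partial> n + c = 1\<close>. Pairing with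
  \<open>F(x, - \<partial> x)\<close> gives \<open>\<lambda>(n, f x) - \<partial> (f x)\<close> in the target and \<open>- \<partial> x\<close> in the source. So \<open>f\<close> matches the
  boundaries after a twist by the preimage of \<open>n\<close>.
\<close>
lemma twist_iso_of_sum_X_iso:
  assumes A: "formed_space A" and B: "formed_space B"
    and iso: "A \<sharp> formed_X \<cong>\<^sub>\<partial> B \<sharp> formed_X"
  shows "\<exists>m. twist A m \<cong>\<^sub>\<partial> B"
proof -
  interpret A: formed_space A by fact
  interpret B: formed_space B by fact
  obtain F G where F: "F \<in> formed_hom (A \<sharp> formed_X) (B \<sharp> formed_X)"
    and G: "G \<in> formed_hom (B \<sharp> formed_X) (A \<sharp> formed_X)"
    and inv: "G \<circ> F = id" "F \<circ> G = id"
    using iso unfolding formed_iso_def by blast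
  have inv': "G (F p) = p" "F (G q) = q" for p q
    using inv by (simp_all add: pointfree_idE)
  let ?f = "kernel_map A F" and ?g = "kernel_map B G"
  have gf: "?g (?f x) = x" for x
    using inv'(1)[of "(x, - fbdry A x)"] by (simp add: kernel_map_lift[OF F] kernel_map_lift[OF G])
  have fg: "?f (?g y) = y" for y
    using inv'(2)[of "(y, - fbdry B y)"] by (simp add: kernel_map_lift[OF F] kernel_map_lift[OF G])
  obtain n c where n: "F (0, 1) = (n, c)" by (cases "F (0, 1)")
  have "fbdry (B \<sharp> formed_X) (F (0, 1)) = fbdry (A \<sharp> formed_X) (0, 1)"
    using F unfolding formed_hom_def by blast
  then have nc: "fbdry B n + c = 1"
    using A.form_simps(8)[of 0 0] by (simp add: n sum_X_simps)
  let ?m = "?g n"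
  have bdry: "fbdry B (?f x) = fbdry (twist A ?m) x" for x
  proof -
    have "fform (B \<sharp> formed_X) (F (0, 1)) (F (x, - fbdry A x))
        = fform (A \<sharp> formed_X) (0, 1) (x, - fbdry A x)"
      using F unfolding formed_hom_def by blast
    then have pairing: "fform B n (?f x) - (fbdry B n + c) * fbdry B (?f x) = - fbdry A x"
      using A.form_simps(8)[of 0 0] A.form_simps(3)[of 0 0]
      by (simp add: n kernel_map_lift[OF F] sum_X_simps algebra_simps)
    have "fform B n (?f x) = fform A ?m x"
      using kernel_map_form[OF F, of ?m x] fg by simp
    then show ?thesis using pairing[unfolded nc] by (simp add: algebra_simps)
  qed
  have bdry': "fbdry (twist A ?m) (?g y) = fbdry B y" for y
    using bdry[of "?g y"] by (simp only: fg)
  have "?f \<in> formed_hom (twist A ?m) B"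
    unfolding formed_hom_def using bdry
    by (simp add: kernel_map_hom[OF A B F] kernel_map_form[OF F] del: twist_simps(3))
  moreover have "?g \<in> formed_hom B (twist A ?m)"
    unfolding formed_hom_def using bdry'
    by (simp add: kernel_map_hom[OF B A G] kernel_map_form[OF G] del: twist_simps(3))
  ultimately have "twist A ?m \<cong>\<^sub>\<partial> B"
    using gf fg by (rule formed_isoI)
  then show ?thesis ..
qed

theorem theoremB1:
  fixes A1 :: "('r::idom, 'm1::ab_group_add) formed"
    and A2 :: "('r, 'm2::ab_group_add) formed"
  assumes "principal_domain (ring_of_type_algebra :: 'r ring)"
    and "formed_space A1" and "formed_space A2"
    and "surj (fbdry A1)" and "surj (fbdry A2)"
    and "A1 \<sharp> formed_X \<cong>\<^sub>\<partial> A2 \<sharp> formed_X"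
  shows "A1 \<cong>\<^sub>\<partial> A2"
proof -
  obtain m where m: "twist A1 m \<cong>\<^sub>\<partial> A2"
    using twist_iso_of_sum_X_iso assms by blast
  have "surj (fbdry (twist A1 m))"
    using surj_bdry_iso[OF m] assms by blast
  then have "twist A1 m \<cong>\<^sub>\<partial> A1"
    using twist_iso assms by blast
  then show ?thesis
    using m formed_iso_sym formed_iso_trans by blast
qed

end
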